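(* $22$ non-overlapping unit squares cannot be packed in a square of side length less than $5$.
   Context: All squares are in the Euclidean plane. Unit squares (closed squares of side length $1$) may be placed in arbitrary position and with arbitrary orientation (rotations are allowed). They are non-overlapping if their interiors are pairwise disjoint, and they are packed in a (closed) square $S$ if each of them is a subset of $S$. *)

theory Defs
  imports "HOL-Analysis.Analysis"
begin

(* c is a corner, and u, v are the directions of the two sides at that corner.  Swapping u and v
   does not change the set, so it does not matter that (u, v) may be negatively oriented. *)
definition is_square :: "real \<Rightarrow> (real^2) set \<Rightarrow> bool" where
  "is_square s S \<longleftrightarrow> s > 0 \<and>
     (\<exists>c u v. norm u = 1 \<and> norm v = 1 \<and> u \<bullet> v = 0 \<and>
        S = {c + a *\<^sub>R u + b *\<^sub>R v | a b. 0 \<le> a \<and> a \<le> s \<and> 0 \<le> b \<and> b \<le> s})"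

definition non_overlapping :: "(real^2) set set \<Rightarrow> bool" where
  "non_overlapping F \<longleftrightarrow> pairwise (\<lambda>A B. disjnt (interior A) (interior B)) F"

definition packed_in :: "(real^2) set set \<Rightarrow> (real^2) set \<Rightarrow> bool" where
  "packed_in F S \<longleftrightarrow> (\<forall>Q\<in>F. Q \<subseteq> S)"

end

theory Submission
  imports Defs
begin

text \<open>
  There is a set of 43 points such that every closed unit square contained in a square of side 5
  contains at least two of them; 22 disjoint squares would need 44. The set consists of five rows
  of seven points at distance 1/2, the rows being 4/5 apart, and of four additional points near
  each of two opposite sides. Away from these two sides the points split into two interleaved
  lattices of triangles with all sides at most 1, and a unit square whose center lies in such a
  triangle contains one of its vertices. Near a side of the large square, it suffices to have
  points at distance at most 1 from the side that are not too far apart. If the large square has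
  side \<open>s < 5\<close>, then the whole configuration is scaled by \<open>s / 5\<close>, so that the points land in the
  interiors of the small squares.
\<close>

section \<open>Rotated unit squares in coordinates\<close>

text \<open>
  The closed unit square with center \<open>(a, b)\<close> and side directions \<open>(C, S)\<close> and \<open>(- S, C)\<close>.
  With \<open>C\<close> and \<open>S\<close> nonnegative, its bounding box has side \<open>C + S\<close>, and a reflection in an
  axis-parallel line interchanges \<open>C\<close> and \<open>S\<close>.
\<close>
definition tilted_square :: "real \<Rightarrow> real \<Rightarrow> real \<Rightarrow> real \<Rightarrow> (real \<times> real) set" where
  "tilted_square C S a b =
     {(x, y). \<bar>(x - a) * C + (y - b) * S\<bar> \<le> 1/2 \<and> \<bar>(y - b) * C - (x - a) * S\<bar> \<le> 1/2}"

lemma tilted_square_swap: "(y, x) \<in> tilted_square S C b a \<longleftrightarrow> (x, y) \<in> tilted_square C S a b"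
  unfolding tilted_square_def by (simp add: add.commute abs_minus_commute)

lemma tilted_square_reflect_fst:
  "(d - x, y) \<in> tilted_square S C (d - a) b \<longleftrightarrow> (x, y) \<in> tilted_square C S a b"
  unfolding tilted_square_def by (auto simp: abs_le_iff algebra_simps)

lemma tilted_square_reflect_snd:
  "(x, d - y) \<in> tilted_square S C a (d - b) \<longleftrightarrow> (x, y) \<in> tilted_square C S a b"
proof -
  have "(x - a) * S + (d - y - (d - b)) * C = - ((y - b) * C - (x - a) * S)"
    "(d - y - (d - b)) * S - (x - a) * C = - ((x - a) * C + (y - b) * S)"
    by (simp_all add: algebra_simps)
  then show ?thesis
    unfolding tilted_square_def by (simp only: mem_Collect_eq case_prod_conv abs_minus_cancel) blast
qed

section \<open>Triangles with sides at most 1\<close>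

text \<open>
  In the next three lemmas, \<open>(a1, b1)\<close>, \<open>(a2, b2)\<close>, \<open>(a3, b3)\<close> are the vertices of a triangle in
  the coordinates of a unit square whose center is the origin. A vertex outside the square has a
  coordinate of absolute value greater than 1/2.
\<close>
lemma triangle_aux:
  fixes a1 a2 a3 b1 b2 b3 :: real
  assumes "l1 \<ge> 0" "l2 \<ge> 0" "l3 \<ge> 0" "l1 + l2 + l3 = 1"
    and "l1 * a1 + l2 * a2 + l3 * a3 = 0" "l1 * b1 + l2 * b2 + l3 * b3 = 0"
    and "a1 > 1/2" "a2 > 1/2" "b3 > 1/2"
    and "a1 - a3 \<le> 1" "a2 - a3 \<le> 1" "b3 - b1 \<le> 1" "b3 - b2 \<le> 1"
  shows False
proof -
  have "l1 * (a1 - 1/2) \<ge> 0" "l2 * (a2 - 1/2) \<ge> 0" "l3 * (a3 + 1/2) \<ge> 0"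
    "l1 * (b1 + 1/2) \<ge> 0" "l2 * (b2 + 1/2) \<ge> 0" "l3 * (b3 - 1/2) \<ge> 0"
    using assms by auto
  then have "l1 * a1 \<ge> l1 / 2" "l2 * a2 \<ge> l2 / 2" "l3 * a3 \<ge> - l3 / 2"
    "l1 * b1 \<ge> - l1 / 2" "l2 * b2 \<ge> - l2 / 2" "l3 * b3 \<ge> l3 / 2"
    by (simp_all add: algebra_simps)
  \<comment> \<open>The \<open>a\<close>-coordinates force \<open>l3 >= 1/2\<close> and the
    \<open>b\<close>-coordinates force \<open>l3 <= 1/2\<close>. So the estimate
    \<open>l3 * b3 >= l3 / 2\<close> is an equality, which the strict bound on \<open>b3\<close>
    forbids.\<close>
  then have "l3 = 1/2" "l3 * b3 = 1/4"
    using assms(4-6) by linarith+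
  moreover have "l3 * (1/2) < l3 * b3"
    using assms(9) \<open>l3 = 1/2\<close> by (intro mult_strict_left_mono) auto
  ultimately show False by simp
qed

lemma triangle_aux_abs:
  fixes a1 a2 a3 b1 b2 b3 :: real
  assumes l: "l1 \<ge> 0" "l2 \<ge> 0" "l3 \<ge> 0" "l1 + l2 + l3 = 1"
    and ab: "l1 * a1 + l2 * a2 + l3 * a3 = 0" "l1 * b1 + l2 * b2 + l3 * b3 = 0"
    and big: "\<bar>a1\<bar> > 1/2" "\<bar>a2\<bar> > 1/2" "\<bar>b3\<bar> > 1/2"
    and d: "\<bar>a1 - a2\<bar> \<le> 1" "\<bar>a1 - a3\<bar> \<le> 1" "\<bar>a2 - a3\<bar> \<le> 1" "\<bar>b1 - b3\<bar> \<le> 1" "\<bar>b2 - b3\<bar> \<le> 1"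
  shows False
proof -
  \<comment> \<open>Two numbers of absolute value above 1/2 that differ by at most 1 have the same
    sign. The signs \<sigma> and \<tau> then reflect the configuration into the position of
    \<open>triangle_aux\<close>.\<close>
  consider "a1 > 1/2 \<and> a2 > 1/2" | "- a1 > 1/2 \<and> - a2 > 1/2"
    using big d by linarith
  then obtain \<sigma> :: real where \<sigma>: "\<sigma> = 1 \<or> \<sigma> = -1" "\<sigma> * a1 > 1/2" "\<sigma> * a2 > 1/2"
    by (metis mult_1 mult_minus1)
  obtain \<tau> :: real where \<tau>: "\<tau> = 1 \<or> \<tau> = -1" "\<tau> * b3 > 1/2"
    using big(3) by (metis abs_if mult_1 mult_minus1)
  have "l1 * (\<sigma> * a1) + l2 * (\<sigma> * a2) + l3 * (\<sigma> * a3) = \<sigma> * (l1 * a1 + l2 * a2 + l3 * a3)"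
    "l1 * (\<tau> * b1) + l2 * (\<tau> * b2) + l3 * (\<tau> * b3) = \<tau> * (l1 * b1 + l2 * b2 + l3 * b3)"
    by (simp_all add: algebra_simps)
  then have "l1 * (\<sigma> * a1) + l2 * (\<sigma> * a2) + l3 * (\<sigma> * a3) = 0"
    "l1 * (\<tau> * b1) + l2 * (\<tau> * b2) + l3 * (\<tau> * b3) = 0"
    using ab by simp_all
  moreover have "\<sigma> * a1 - \<sigma> * a3 \<le> 1" "\<sigma> * a2 - \<sigma> * a3 \<le> 1"
    "\<tau> * b3 - \<tau> * b1 \<le> 1" "\<tau> * b3 - \<tau> * b2 \<le> 1"
    using \<sigma>(1) \<tau>(1) d by auto
  ultimately show False
    using triangle_aux[OF l, of "\<sigma> * a1" "\<sigma> * a2" "\<sigma> * a3" "\<tau> * b1" "\<tau> * b2" "\<tau> * b3"] \<sigma> \<tau>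
    by blast
qed

lemma triangle_aux_same:
  fixes a1 a2 a3 :: real
  assumes "l1 \<ge> 0" "l2 \<ge> 0" "l3 \<ge> 0" "l1 + l2 + l3 = 1"
    and "l1 * a1 + l2 * a2 + l3 * a3 = 0"
    and "\<bar>a1\<bar> > 1/2" "\<bar>a2\<bar> > 1/2" "\<bar>a3\<bar> > 1/2"
    and "\<bar>a1 - a2\<bar> \<le> 1" "\<bar>a1 - a3\<bar> \<le> 1"
  shows False
proof -
  consider "a1 > 1/2" "a2 > 1/2" "a3 > 1/2" | "a1 < -1/2" "a2 < -1/2" "a3 < -1/2"
    using assms(6-) by linarith
  then show False
  proof cases
    case 1
    then have "l1 * (a1 - 1/2) \<ge> 0" "l2 * (a2 - 1/2) \<ge> 0" "l3 * (a3 - 1/2) \<ge> 0"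
      using assms by auto
    then show False using assms(4,5) by (simp add: algebra_simps)
  next
    case 2
    then have "l1 * (- a1 - 1/2) \<ge> 0" "l2 * (- a2 - 1/2) \<ge> 0" "l3 * (- a3 - 1/2) \<ge> 0"
      using assms by auto
    then show False using assms(4,5) by (simp add: algebra_simps)
  qed
qed

text \<open>Twice the signed area of a triangle, positive for counterclockwise vertices.\<close>

definition cross :: "real \<Rightarrow> real \<Rightarrow> real \<Rightarrow> real \<Rightarrow> real \<Rightarrow> real \<Rightarrow> real" where
  "cross x1 y1 x2 y2 x3 y3 = (x2 - x1) * (y3 - y1) - (x3 - x1) * (y2 - y1)"

text \<open>A rotation preserves length, and a coordinate never exceeds the length.\<close>

lemma rotated_coordinates_le:
  fixes C S x y :: real
  assumes "C\<^sup>2 + S\<^sup>2 = 1" "x\<^sup>2 + y\<^sup>2 \<le> r\<^sup>2" "r \<ge> 0"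
  shows "\<bar>x * C + y * S\<bar> \<le> r" "\<bar>y * C - x * S\<bar> \<le> r"
proof -
  have "(x * C + y * S)\<^sup>2 + (y * C - x * S)\<^sup>2 = (x\<^sup>2 + y\<^sup>2) * (C\<^sup>2 + S\<^sup>2)" by algebra
  then have "(x * C + y * S)\<^sup>2 \<le> r\<^sup>2" "(y * C - x * S)\<^sup>2 \<le> r\<^sup>2"
    using assms(1,2) zero_le_power2[of "x * C + y * S"] zero_le_power2[of "y * C - x * S"]
    unfolding assms(1) mult_1_right by linarith+
  then show "\<bar>x * C + y * S\<bar> \<le> r" "\<bar>y * C - x * S\<bar> \<le> r"
    using assms(3) by (simp_all add: abs_le_square_iff[symmetric])
qed

locale unit_square =
  fixes C S a b :: real
  assumes C_nonneg: "0 \<le> C" and S_nonneg: "0 \<le> S" and CS: "C\<^sup>2 + S\<^sup>2 = 1"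
begin

abbreviation "Q \<equiv> tilted_square C S a b"

lemma disc_hit:
  assumes "(x - a)\<^sup>2 + (y - b)\<^sup>2 \<le> 1/4"
  shows "(x, y) \<in> Q"
  using rotated_coordinates_le[OF CS, of "x - a" "y - b" "1/2"] assms
  by (simp add: tilted_square_def power2_eq_square)

text \<open>The signed areas of the three subtriangles at the center, divided by the whole area, are
  its barycentric coordinates \<open>l1\<close>, \<open>l2\<close>, \<open>l3\<close>. They survive
  the passage to the rotated coordinates \<open>f\<close> and \<open>g\<close>, in which vertices
  differ by at most 1.\<close>

lemma triangle_hit:
  assumes d: "(x1 - x2)\<^sup>2 + (y1 - y2)\<^sup>2 \<le> 1" "(x1 - x3)\<^sup>2 + (y1 - y3)\<^sup>2 \<le> 1"
      "(x2 - x3)\<^sup>2 + (y2 - y3)\<^sup>2 \<le> 1"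
    and pos: "cross x1 y1 x2 y2 x3 y3 > 0"
    and inside: "cross a b x2 y2 x3 y3 \<ge> 0" "cross x1 y1 a b x3 y3 \<ge> 0" "cross x1 y1 x2 y2 a b \<ge> 0"
  shows "(x1, y1) \<in> Q \<or> (x2, y2) \<in> Q \<or> (x3, y3) \<in> Q"
proof (rule ccontr)
  define A where "A = cross x1 y1 x2 y2 x3 y3"
  define l1 where "l1 = cross a b x2 y2 x3 y3 / A"
  define l2 where "l2 = cross x1 y1 a b x3 y3 / A"
  define l3 where "l3 = cross x1 y1 x2 y2 a b / A"
  have A: "A > 0" using pos by (simp add: A_def)
  have l: "l1 \<ge> 0" "l2 \<ge> 0" "l3 \<ge> 0"
    using inside A by (simp_all add: l1_def l2_def l3_def)
  have "cross a b x2 y2 x3 y3 + cross x1 y1 a b x3 y3 + cross x1 y1 x2 y2 a b = A"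
    by (simp add: A_def cross_def algebra_simps)
  then have l_sum: "l1 + l2 + l3 = 1"
    using A by (simp add: l1_def l2_def l3_def field_simps)
  have "cross a b x2 y2 x3 y3 * (x1 - a) + cross x1 y1 a b x3 y3 * (x2 - a)
      + cross x1 y1 x2 y2 a b * (x3 - a) = 0"
    "cross a b x2 y2 x3 y3 * (y1 - b) + cross x1 y1 a b x3 y3 * (y2 - b)
      + cross x1 y1 x2 y2 a b * (y3 - b) = 0"
    unfolding cross_def by algebra+
  then have lx: "l1 * (x1 - a) + l2 * (x2 - a) + l3 * (x3 - a) = 0"
    and ly: "l1 * (y1 - b) + l2 * (y2 - b) + l3 * (y3 - b) = 0"
    unfolding l1_def l2_def l3_def times_divide_eq_left add_divide_distrib[symmetric] by simp_all
  define f where "f x y = (x - a) * C + (y - b) * S" for x y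
  define g where "g x y = (y - b) * C - (x - a) * S" for x y
  have lf: "l1 * f x1 y1 + l2 * f x2 y2 + l3 * f x3 y3 = 0"
    and lg: "l1 * g x1 y1 + l2 * g x2 y2 + l3 * g x3 y3 = 0"
    using lx ly unfolding f_def g_def by algebra+
  have diff: "f x y - f x' y' = (x - x') * C + (y - y') * S"
     "g x y - g x' y' = (y - y') * C - (x - x') * S" for x y x' y'
    by (simp_all add: f_def g_def algebra_simps)
  have df: "\<bar>f x1 y1 - f x2 y2\<bar> \<le> 1" "\<bar>f x1 y1 - f x3 y3\<bar> \<le> 1" "\<bar>f x2 y2 - f x3 y3\<bar> \<le> 1"
    "\<bar>g x1 y1 - g x2 y2\<bar> \<le> 1" "\<bar>g x1 y1 - g x3 y3\<bar> \<le> 1" "\<bar>g x2 y2 - g x3 y3\<bar> \<le> 1"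
    unfolding diff using rotated_coordinates_le[OF CS, of _ _ 1] d by simp_all
  have df': "\<bar>f x2 y2 - f x1 y1\<bar> \<le> 1" "\<bar>f x3 y3 - f x1 y1\<bar> \<le> 1" "\<bar>f x3 y3 - f x2 y2\<bar> \<le> 1"
    "\<bar>g x2 y2 - g x1 y1\<bar> \<le> 1" "\<bar>g x3 y3 - g x1 y1\<bar> \<le> 1" "\<bar>g x3 y3 - g x2 y2\<bar> \<le> 1"
    using df by (simp_all add: abs_minus_commute)
  have perm: "l1 + l3 + l2 = 1" "l2 + l3 + l1 = 1"
    "l1 * f x1 y1 + l3 * f x3 y3 + l2 * f x2 y2 = 0" "l1 * g x1 y1 + l3 * g x3 y3 + l2 * g x2 y2 = 0"
    "l2 * f x2 y2 + l3 * f x3 y3 + l1 * f x1 y1 = 0" "l2 * g x2 y2 + l3 * g x3 y3 + l1 * g x1 y1 = 0"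
    using l_sum lf lg by linarith+
  assume "\<not> ?thesis"
  then have out: "\<bar>f x1 y1\<bar> > 1/2 \<or> \<bar>g x1 y1\<bar> > 1/2" "\<bar>f x2 y2\<bar> > 1/2 \<or> \<bar>g x2 y2\<bar> > 1/2"
    "\<bar>f x3 y3\<bar> > 1/2 \<or> \<bar>g x3 y3\<bar> > 1/2"
    by (auto simp: tilted_square_def f_def g_def)
  \<comment> \<open>By pigeonhole, at least two of three outside vertices are outside in the same
    coordinate. \<open>same\<close> covers all three sharing a coordinate; \<open>m12\<close>,
    \<open>m13\<close>, \<open>m23\<close> cover the pairs whose third vertex is outside in the
    other one.\<close>
  note same = triangle_aux_same[OF l l_sum lf _ _ _ df(1,2)] triangle_aux_same[OF l l_sum lg _ _ _ df(4,5)]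
  note m12 = triangle_aux_abs[OF l l_sum lf lg _ _ _ df(1,2,3,5,6)]
    triangle_aux_abs[OF l l_sum lg lf _ _ _ df(4,5,6,2,3)]
  note m13 = triangle_aux_abs[OF l(1,3,2) perm(1,3,4) _ _ _ df(2,1) df'(3) df(4) df'(6)]
    triangle_aux_abs[OF l(1,3,2) perm(1,4,3) _ _ _ df(5,4) df'(6) df(1) df'(3)]
  note m23 = triangle_aux_abs[OF l(2,3,1) perm(2,5,6) _ _ _ df(3) df'(1,2,4,5)]
    triangle_aux_abs[OF l(2,3,1) perm(2,6,5) _ _ _ df(6) df'(4,5,1,2)]
  show False using out same m12 m13 m23 by blast
qed

end

section \<open>Squares near a side or a corner of the large square\<close>

text \<open>Half the bounding box has side \<open>(C + S) / 2\<close>, so the assumptions place the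
  square in the first quadrant.\<close>

locale square_in_quadrant = unit_square +
  assumes a_ge: "(C + S) / 2 \<le> a" and b_ge: "(C + S) / 2 \<le> b"
begin

text \<open>A point at distance at most 1 from a coordinate axis exceeds the center by at most
  \<open>1 - (C + S) / 2\<close> in that direction. The bounds follow by completing the
  square.\<close>

lemma wall_bounds:
  assumes "d \<le> 1 - (C + S) / 2"
  shows "d * C \<le> 1/2" "d * S \<le> 1/2"
proof -
  have "d * C \<le> (1 - (C + S) / 2) * C" "d * S \<le> (1 - (C + S) / 2) * S"
    using assms C_nonneg S_nonneg by (simp_all add: mult_right_mono)
  moreover have eq: "(1 - (C + S) / 2) * C = 1/2 - ((1 - C)\<^sup>2 + C * S) / 2"
    "(1 - (C + S) / 2) * S = 1/2 - ((1 - S)\<^sup>2 + C * S) / 2"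
    by (simp_all add: power2_eq_square field_simps)
  moreover have "0 \<le> ((1 - C)\<^sup>2 + C * S) / 2" "0 \<le> ((1 - S)\<^sup>2 + C * S) / 2"
    using C_nonneg S_nonneg by simp_all
  ultimately show "d * C \<le> 1/2" "d * S \<le> 1/2"
    unfolding eq by linarith+
qed

text \<open>Both offsets from the center are nonnegative. One rotated coordinate is a difference of
  two numbers in [0, 1/2]; the other is a sum, bounded by 1/2 minus a square.\<close>

lemma corner_hit:
  assumes "a \<le> x" "x \<le> 1" "b \<le> y" "y \<le> 1"
  shows "(x, y) \<in> Q"
proof -
  let ?h = "(C + S) / 2"
  have d: "x - a \<le> 1 - ?h" "y - b \<le> 1 - ?h"
    using assms a_ge b_ge by linarith+
  have "(x - a) * C + (y - b) * S \<le> (1 - ?h) * C + (1 - ?h) * S"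
    by (intro add_mono mult_right_mono d C_nonneg S_nonneg)
  also have "\<dots> = 1/2 - (1 - C - S)\<^sup>2 / 2"
    by (simp add: power2_eq_square field_simps)
  also have "\<dots> \<le> 1/2" by simp
  finally have "(x - a) * C + (y - b) * S \<le> 1/2" .
  moreover have "0 \<le> (x - a) * C" "0 \<le> (y - b) * S" "0 \<le> (y - b) * C" "0 \<le> (x - a) * S"
    using assms C_nonneg S_nonneg by simp_all
  ultimately show ?thesis
    using wall_bounds[OF d(1)] wall_bounds[OF d(2)] unfolding tilted_square_def
    by (auto simp only: mem_Collect_eq case_prod_conv abs_le_iff)
qed

text \<open>The constant 14/5 stands for \<open>2 * sqrt 2\<close>; the worst case is a square tilted by 45 degrees.\<close>
lemma floor_hit:
  assumes x: "x1 \<le> a" "a \<le> x2" and y: "b \<le> y1" "b \<le> y2" "y1 \<le> D" "y2 \<le> D"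
    and D: "D \<le> 1" "x2 - x1 + 2 * D \<le> 14/5" and dist: "(x2 - x1)\<^sup>2 + (y2 - y1)\<^sup>2 \<le> 1"
  shows "(x1, y1) \<in> Q \<or> (x2, y2) \<in> Q"
proof (rule ccontr)
  define \<alpha> \<beta> d e where "\<alpha> = a - x1" "\<beta> = x2 - a" "d = y1 - b" "e = y2 - b"
  note defs = this
  let ?h = "(C + S) / 2"
  have nn: "0 \<le> \<alpha>" "0 \<le> \<beta>" "0 \<le> d" "0 \<le> e" using x y by (simp_all add: defs)
  have de: "d \<le> D - ?h" "e \<le> D - ?h" using y b_ge unfolding defs by linarith+
  then have "d \<le> 1 - ?h" "e \<le> 1 - ?h" using D by linarith+
  note wb = wall_bounds[OF this(1)] wall_bounds[OF this(2)]
  have prods: "0 \<le> \<alpha> * C" "0 \<le> \<alpha> * S" "0 \<le> \<beta> * C" "0 \<le> \<beta> * S" "0 \<le> d * C" "0 \<le> d * S" "0 \<le> e * C" "0 \<le> e * S"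
    using nn C_nonneg S_nonneg by simp_all
  have CS_le: "C * S \<le> 1/2"
    using CS zero_le_power2[of "C - S"] by (simp add: power2_diff)
  have gap: "\<alpha> + \<beta> \<le> 1"
  proof -
    have "(x2 - x1)\<^sup>2 \<le> 1\<^sup>2" using dist zero_le_power2[of "y2 - y1"] unfolding one_power2 by linarith
    then show ?thesis using power2_le_imp_le[of "x2 - x1" 1] by (simp add: defs)
  qed
  have "\<bar>(\<alpha> + \<beta>) * C + (e - d) * S\<bar> \<le> 1" "\<bar>(e - d) * C - (\<alpha> + \<beta>) * S\<bar> \<le> 1"
    using rotated_coordinates_le[OF CS, of "x2 - x1" "y2 - y1" 1] dist by (simp_all add: defs)
  then have far: "\<beta> * C + e * S - (d * S - \<alpha> * C) \<le> 1" "d * C + \<alpha> * S - (e * C - \<beta> * S) \<le> 1"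
    by (simp_all add: algebra_simps abs_le_iff)
  assume "\<not> ?thesis"
  then have "\<bar>d * S - \<alpha> * C\<bar> > 1/2 \<or> \<bar>d * C + \<alpha> * S\<bar> > 1/2" "\<bar>\<beta> * C + e * S\<bar> > 1/2 \<or> \<bar>e * C - \<beta> * S\<bar> > 1/2"
    by (auto simp: tilted_square_def defs algebra_simps)
  then have p: "\<alpha> * C - d * S > 1/2 \<or> d * C + \<alpha> * S > 1/2"
    and q: "\<beta> * C + e * S > 1/2 \<or> \<beta> * S - e * C > 1/2"
    using prods wb by linarith+
  \<comment> \<open>Points at distance at most 1 cannot lie beyond opposite sides of the unit
    square; this removes the two mixed cases. In the first remaining case the products give
    \<open>\<alpha> * \<beta> > 1/2\<close>, against
    \<open>\<alpha> + \<beta> \<le> 1\<close>.\<close>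
  consider "\<alpha> * C - d * S > 1/2" "\<beta> * S - e * C > 1/2" | "d * C + \<alpha> * S > 1/2" "\<beta> * C + e * S > 1/2"
    using p q far by linarith
  then show False
  proof cases
    case 1
    then have "\<alpha> * C > 1/2" "\<beta> * S > 1/2" using prods by linarith+
    then have "(1/2) * (1/2) < (\<alpha> * C) * (\<beta> * S)" by (intro mult_strict_mono) auto
    also have "\<dots> = (\<alpha> * \<beta>) * (C * S)" by simp
    also have "\<dots> \<le> (\<alpha> * \<beta>) * (1/2)" using CS_le nn by (intro mult_left_mono) auto
    finally have "\<alpha> * \<beta> > 1/2" by simp
    moreover have "(\<alpha> + \<beta>)\<^sup>2 \<le> 1" using gap nn by (simp add: power_le_one)
    ultimately show False
      using zero_le_power2[of "\<alpha> - \<beta>"] by (simp add: power2_sum power2_diff)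
  next
    case 2
    \<comment> \<open>Combining the two inequalities with weights \<open>C\<close> and \<open>S\<close> bounds \<open>C + S\<close> from above by an
      affine function of \<open>k = (C + S)\<^sup>2 - 1\<close>, which contradicts \<open>1 \<le> C + S \<le> 3/2\<close>.\<close>
    define k where "k = 2 * (C * S)"
    have lam: "0 \<le> k" "k \<le> 1" using CS_le C_nonneg S_nonneg by (simp_all add: k_def)
    have H2: "(C + S)\<^sup>2 = 1 + k" using CS by (simp add: power2_sum k_def)
    have H: "1 \<le> C + S" "C + S \<le> 3/2"
      using H2 lam C_nonneg S_nonneg power2_le_imp_le[of 1 "C + S"] power2_le_imp_le[of "C + S" "3/2"]
      by (simp_all add: power2_eq_square)
    have "0 \<le> (d * C + \<alpha> * S - 1/2) * C" "0 \<le> (\<beta> * C + e * S - 1/2) * S"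
      using 2 C_nonneg S_nonneg by simp_all
    moreover have "0 < (d * C + \<alpha> * S - 1/2) * C \<or> 0 < (\<beta> * C + e * S - 1/2) * S"
      using 2 H C_nonneg S_nonneg by (cases "C = 0") auto
    ultimately have "0 < (d * C + \<alpha> * S - 1/2) * C + (\<beta> * C + e * S - 1/2) * S" by linarith
    also have "\<dots> = d * C\<^sup>2 + e * S\<^sup>2 + (\<alpha> + \<beta>) * (C * S) - (C + S) / 2"
      by (simp add: power2_eq_square field_simps)
    also have "\<dots> \<le> (D - ?h) * C\<^sup>2 + (D - ?h) * S\<^sup>2 + (\<alpha> + \<beta>) * (C * S) - (C + S) / 2"
      using de by (intro diff_right_mono add_right_mono add_mono mult_right_mono) auto
    also have "\<dots> = D - (C + S) + (\<alpha> + \<beta>) * k / 2"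
      using CS by (simp add: distrib_left[symmetric] k_def)
    finally have "C + S < D + (\<alpha> + \<beta>) * k / 2" by simp
    \<comment> \<open>The right-hand side is
      \<open>(1 - k) * D + k * (\<alpha> + \<beta> + 2 * D) / 2\<close>, hence at most
      \<open>(1 - k) + 7/5 * k\<close>.\<close>
    moreover have "k * (\<alpha> + \<beta> + 2 * D) \<le> k * (14/5)" "(1 - k) * D \<le> (1 - k) * 1"
      using D lam by (intro mult_left_mono; simp add: defs)+
    ultimately have "C + S < 1 + 2/5 * k" by argo
    moreover have "0 \<le> (C + S - 1) * (3/2 - (C + S))" using H by simp
    then have "(C + S)\<^sup>2 \<le> 5/2 * (C + S) - 3/2" by (simp add: power2_eq_square field_simps)
    ultimately show False using H2 by argo
  qed
qed

lemma swapped: "square_in_quadrant S C b a"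
  using C_nonneg S_nonneg CS a_ge b_ge by unfold_locales (simp_all add: add.commute)

text \<open>This is \<open>floor_hit\<close> reflected in the diagonal of the quadrant.\<close>

lemma wall_hit:
  assumes "y1 \<le> b" "b \<le> y2" "a \<le> x1" "a \<le> x2" "x1 \<le> D" "x2 \<le> D"
    and "D \<le> 1" "y2 - y1 + 2 * D \<le> 14/5" "(x2 - x1)\<^sup>2 + (y2 - y1)\<^sup>2 \<le> 1"
  shows "(x1, y1) \<in> Q \<or> (x2, y2) \<in> Q"
proof -
  interpret sw: square_in_quadrant S C b a by (rule swapped)
  show ?thesis using sw.floor_hit[of y1 y2 x1 x2 D] assms by (simp add: tilted_square_swap add.commute)
qed

end

section \<open>Two interleaved triangulated strips between consecutive rows\<close>

context unit_square
begin

text \<open>The legs have squared length 1/4 + 16/25 < 1 and slopes 8/5 and -8/5, which gives the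
  form of the assumptions.\<close>

lemma up_triangle_hit:
  assumes "y \<le> b" "5 * (b - y) \<le> 8 * (a - z)" "5 * (b - y) \<le> 8 * (z + 1 - a)"
  shows "(z, y) \<in> Q \<or> (z + 1, y) \<in> Q \<or> (z + 1/2, y + 4/5) \<in> Q"
  using assms by (intro triangle_hit) (simp_all add: cross_def power2_eq_square field_simps)

lemma down_triangle_hit:
  assumes "b \<le> y + 4/5" "4 - 5 * (b - y) \<le> 8 * (a - z)" "4 - 5 * (b - y) \<le> 8 * (z + 1 - a)"
  shows "(z + 1/2, y) \<in> Q \<or> (z + 1, y + 4/5) \<in> Q \<or> (z, y + 4/5) \<in> Q"
  using assms by (intro triangle_hit) (simp_all add: cross_def power2_eq_square field_simps)

text \<open>The strip consists of an upward, a downward and an upward triangle. The assumptions on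
  \<open>a\<close> keep the center inside this trapezoid.\<close>

lemma zigzag_hit_integers_below:
  assumes y: "y \<le> b" "b \<le> y + 4/5" and a: "5 * (b - y) \<le> 8 * (a - 1)" "a \<le> 5/2"
  shows "Q \<inter> ({1, 2, 3} \<times> {y} \<union> {3/2, 5/2} \<times> {y + 4/5}) \<noteq> {}"
proof -
  consider "5 * (b - y) \<le> 8 * (2 - a)" | "8 * (2 - a) \<le> 5 * (b - y)" "8 * (a - 2) \<le> 5 * (b - y)"
    | "5 * (b - y) \<le> 8 * (a - 2)" by linarith
  then show ?thesis
  proof cases
    case 1
    have "(1, y) \<in> Q \<or> (2, y) \<in> Q \<or> (3/2, y + 4/5) \<in> Q"
      using up_triangle_hit[of y 1] y(1) a(1) 1 by simp
    then show ?thesis by auto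
  next
    case 2
    have "4 - 5 * (b - y) \<le> 8 * (a - 3/2)" "4 - 5 * (b - y) \<le> 8 * (3/2 + 1 - a)"
      using 2 by simp_all
    then have "(2, y) \<in> Q \<or> (5/2, y + 4/5) \<in> Q \<or> (3/2, y + 4/5) \<in> Q"
      using down_triangle_hit[of y "3/2"] y(2) by simp
    then show ?thesis by auto
  next
    case 3
    have "5 * (b - y) \<le> 8 * (2 + 1 - a)" using y a by argo
    then have "(2, y) \<in> Q \<or> (3, y) \<in> Q \<or> (5/2, y + 4/5) \<in> Q"
      using up_triangle_hit[of y 2] y(1) 3 by simp
    then show ?thesis by auto
  qed
qed

text \<open>The same trapezoid upside down. Its vertices are disjoint from those of
  \<open>zigzag_hit_integers_below\<close>, so a center in both yields two points.\<close>

lemma zigzag_hit_integers_above: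
  assumes y: "y \<le> b" "b \<le> y + 4/5" and a: "4 - 5 * (b - y) \<le> 8 * (a - 1)" "a \<le> 5/2"
  shows "Q \<inter> ({3/2, 5/2} \<times> {y} \<union> {1, 2, 3} \<times> {y + 4/5}) \<noteq> {}"
proof -
  consider "4 - 5 * (b - y) \<le> 8 * (2 - a)"
    | "8 * (2 - a) \<le> 4 - 5 * (b - y)" "8 * (a - 2) \<le> 4 - 5 * (b - y)"
    | "4 - 5 * (b - y) \<le> 8 * (a - 2)" by linarith
  then show ?thesis
  proof cases
    case 1
    have "(3/2, y) \<in> Q \<or> (2, y + 4/5) \<in> Q \<or> (1, y + 4/5) \<in> Q"
      using down_triangle_hit[of y 1] y(2) a(1) 1 by simp
    then show ?thesis by auto
  next
    case 2
    have "5 * (b - y) \<le> 8 * (a - 3/2)" "5 * (b - y) \<le> 8 * (3/2 + 1 - a)"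
      using 2 by simp_all
    then have "(3/2, y) \<in> Q \<or> (5/2, y) \<in> Q \<or> (2, y + 4/5) \<in> Q"
      using up_triangle_hit[of y "3/2"] y(1) by simp
    then show ?thesis by auto
  next
    case 3
    have "4 - 5 * (b - y) \<le> 8 * (2 + 1 - a)" using y a by argo
    then have "(5/2, y) \<in> Q \<or> (3, y + 4/5) \<in> Q \<or> (2, y + 4/5) \<in> Q"
      using down_triangle_hit[of y 2] y(2) 3 by simp
    then show ?thesis by auto
  qed
qed

end

section \<open>The 43 points\<close>

text \<open>The distances are tight for \<open>floor_hit\<close> and \<open>wall_hit\<close>: gap 1
  at distance 9/10 from a side, and gap 4/5 at distance 1, both give
  \<open>gap + 2 * D = 14/5\<close>. The set is symmetric in both midlines of the square of side
  5.\<close>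

definition piercing_points :: "(real \<times> real) set" where
  "piercing_points = {1, 3/2, 2, 5/2, 3, 7/2, 4} \<times> {9/10, 17/10, 5/2, 33/10, 41/10} \<union> {9/10, 41/10} \<times> {1, 2, 3, 4}"

lemma finite_piercing_points: "finite piercing_points"
  by (simp add: piercing_points_def)

lemma card_piercing_points: "card piercing_points \<le> 43"
proof -
  have "card piercing_points \<le> card ({1, 3/2, 2, 5/2, 3, 7/2, 4 :: real} \<times> {9/10, 17/10, 5/2, 33/10, 41/10 :: real})
      + card ({9/10, 41/10 :: real} \<times> {1, 2, 3, 4 :: real})"
    unfolding piercing_points_def by (rule card_Un_le)
  also have "\<dots> = 43" by (simp add: card_cartesian_product)
  finally show ?thesis .
qed

lemma card_ge_two:
  assumes "Q \<inter> U \<noteq> {}" "Q \<inter> V \<noteq> {}" "U \<subseteq> piercing_points" "V \<subseteq> piercing_points" "U \<inter> V = {}"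
  shows "2 \<le> card (Q \<inter> piercing_points)"
proof -
  obtain p q where "p \<in> Q \<inter> U" "q \<in> Q \<inter> V" using assms by blast
  then have "{p, q} \<subseteq> Q \<inter> piercing_points" "p \<noteq> q" using assms by auto
  then show ?thesis using card_mono[of "Q \<inter> piercing_points" "{p, q}"] finite_piercing_points by simp
qed

section \<open>Two points when the center is in the lower left quarter\<close>

context square_in_quadrant
begin

lemma first_column_hit:
  assumes "a \<le> 1" "b \<le> 5/2"
  shows "Q \<inter> {1} \<times> {9/10, 17/10, 5/2} \<noteq> {}"
proof -
  consider "b \<le> 9/10" | "9/10 \<le> b" "b \<le> 17/10" | "17/10 \<le> b" by linarith
  then show ?thesis
  proof cases
    case 1
    then show ?thesis using corner_hit[of 1 "9/10"] assms by auto
  next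
    case 2
    then show ?thesis using wall_hit[of "9/10" "17/10" 1 1 1] assms by (auto simp: power2_eq_square)
  next
    case 3
    then show ?thesis using wall_hit[of "17/10" "5/2" 1 1 1] assms by (auto simp: power2_eq_square)
  qed
qed

text \<open>These points avoid the column \<open>x = 1\<close>, so they can supply a second point
  next to one from that column.\<close>

lemma side_hit:
  assumes "a \<le> 3/2" "b \<le> 5/2"
  shows "Q \<inter> ({9/10} \<times> {1, 2, 3} \<union> {3/2} \<times> {9/10, 17/10, 5/2}) \<noteq> {}"
proof -
  \<comment> \<open>Between \<open>x = 9/10\<close> and \<open>x = 3/2\<close>, the sloped bounds
    are the segments joining points of the two columns; they cut out a sliver (case 5) and triangles
    (cases 6 to 9).\<close>
  consider "a \<le> 9/10" "b \<le> 1" | "a \<le> 9/10" "1 \<le> b" "b \<le> 2" | "a \<le> 9/10" "2 \<le> b"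
    | "9/10 \<le> a" "b \<le> 9/10"
    | "9/10 \<le> a" "9/10 \<le> b" "b \<le> 1 - (a - 9/10) / 6"
    | "9/10 \<le> a" "1 - (a - 9/10) / 6 \<le> b" "b \<le> 1 + (a - 9/10) * (7/6)"
    | "9/10 \<le> a" "1 + (a - 9/10) * (7/6) \<le> b" "b \<le> 2 - (a - 9/10) / 2"
    | "9/10 \<le> a" "2 - (a - 9/10) / 2 \<le> b" "b \<le> 2 + (a - 9/10) * (5/6)"
    | "9/10 \<le> a" "2 + (a - 9/10) * (5/6) \<le> b"
    by (meson linear)
  then show ?thesis
  proof cases
    case 1
    then show ?thesis using corner_hit[of "9/10" 1] by auto
  next
    case 2
    then show ?thesis using wall_hit[of 1 2 "9/10" "9/10" "9/10"] by (auto simp: power2_eq_square)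
  next
    case 3
    then show ?thesis using wall_hit[of 2 3 "9/10" "9/10" "9/10"] assms by (auto simp: power2_eq_square)
  next
    case 4
    then show ?thesis using floor_hit[of "9/10" "3/2" 1 "9/10" 1] assms by (auto simp: power2_eq_square)
  next
    case 5
    \<comment> \<open>The sliver has width 3/5 and height 1/10, so one of the two points is within
      3/10 horizontally and 1/10 vertically of the center.\<close>
    have "(9/10 - a)\<^sup>2 + (1 - b)\<^sup>2 \<le> 1/4 \<or> (3/2 - a)\<^sup>2 + (9/10 - b)\<^sup>2 \<le> 1/4"
    proof -
      have "\<bar>9/10 - a\<bar> \<le> 3/10 \<or> \<bar>3/2 - a\<bar> \<le> 3/10" "\<bar>1 - b\<bar> \<le> 1/10" "\<bar>9/10 - b\<bar> \<le> 1/10"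
        using 5 assms by argo+
      then have "(9/10 - a)\<^sup>2 \<le> (3/10)\<^sup>2 \<or> (3/2 - a)\<^sup>2 \<le> (3/10)\<^sup>2"
        "(1 - b)\<^sup>2 \<le> (1/10)\<^sup>2" "(9/10 - b)\<^sup>2 \<le> (1/10)\<^sup>2"
        by (simp_all only: abs_le_square_iff[symmetric] abs_divide abs_numeral abs_one)
      then show ?thesis by (auto simp: power_divide)
    qed
    then have "(9/10, 1) \<in> Q \<or> (3/2, 9/10) \<in> Q" using disc_hit by blast
    then show ?thesis by auto
  next
    case 6
    have "(9/10, 1) \<in> Q \<or> (3/2, 9/10) \<in> Q \<or> (3/2, 17/10) \<in> Q"
      using 6 assms by (intro triangle_hit) (simp_all add: cross_def power2_eq_square field_simps)
    then show ?thesis by auto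
  next
    case 7
    have "(9/10, 1) \<in> Q \<or> (3/2, 17/10) \<in> Q \<or> (9/10, 2) \<in> Q"
      using 7 assms by (intro triangle_hit) (simp_all add: cross_def power2_eq_square field_simps)
    then show ?thesis by auto
  next
    case 8
    have "(9/10, 2) \<in> Q \<or> (3/2, 17/10) \<in> Q \<or> (3/2, 5/2) \<in> Q"
      using 8 assms by (intro triangle_hit) (simp_all add: cross_def power2_eq_square field_simps)
    then show ?thesis by auto
  next
    case 9
    have "(9/10, 2) \<in> Q \<or> (3/2, 5/2) \<in> Q \<or> (9/10, 3) \<in> Q"
      using 9 assms by (intro triangle_hit) (simp_all add: cross_def power2_eq_square field_simps)
    then show ?thesis by auto
  qed
qed

text \<open>
  The last assumption says that \<open>(a, b)\<close> lies to the left of one of the two diagonals of the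
  rectangle with vertices \<open>(1, y)\<close> and \<open>(3/2, y + 4/5)\<close>, that is, outside one of the two triangulated
  regions.
\<close>
lemma first_column_disc_hit:
  assumes "1 \<le> a" "a \<le> 3/2" "y \<le> b" "b \<le> y + 4/5"
    and "8 * (a - 1) \<le> 5 * (b - y) \<or> 8 * (a - 1) \<le> 4 - 5 * (b - y)"
  shows "(1, y) \<in> Q \<or> (1, y + 4/5) \<in> Q"
proof -
  define \<xi> where "\<xi> = a - 1"
  \<comment> \<open>Vertical distance to the nearer row; with it, both diagonal conditions become
    \<open>5 * \<eta> \<le> 4 - 8 * \<xi>\<close>.\<close>
  define \<eta> where "\<eta> = min (b - y) (y + 4/5 - b)"
  have \<xi>: "0 \<le> \<xi>" "\<xi> \<le> 1/2" and \<eta>: "0 \<le> \<eta>" "\<eta> \<le> 2/5" "5 * \<eta> \<le> 4 - 8 * \<xi>"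
    using assms by (auto simp: \<xi>_def \<eta>_def min_def field_simps)
  have "\<xi>\<^sup>2 + \<eta>\<^sup>2 \<le> 1/4"
  proof (cases "\<xi> \<le> 1/4")
    case True
    then have "\<xi>\<^sup>2 \<le> (1/4)\<^sup>2" "\<eta>\<^sup>2 \<le> (2/5)\<^sup>2" using \<xi> \<eta> by (intro power_mono; simp)+
    then show ?thesis by (simp add: power2_eq_square)
  next
    case False
    have "\<eta>\<^sup>2 \<le> (4/5 - 8/5 * \<xi>)\<^sup>2" using \<eta> by (intro power_mono) auto
    \<comment> \<open>The remaining bound is a convex quadratic in \<xi>, so its values at 1/4 and
      1/2 decide; at 1/2 it equals 1/4.\<close>
    moreover have "0 \<le> (\<xi> - 1/4) * (1/2 - \<xi>)" using False \<xi> by simp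
    ultimately show ?thesis using \<xi> by (simp add: power2_eq_square algebra_simps)
  qed
  then show ?thesis
    using disc_hit[of 1 y] disc_hit[of 1 "y + 4/5"]
    by (auto simp: \<xi>_def \<eta>_def min_def power2_commute split: if_splits)
qed

lemma two_points_quadrant:
  assumes "a \<le> 5/2" "b \<le> 5/2"
  shows "2 \<le> card (Q \<inter> piercing_points)"
proof -
  \<comment> \<open>Right of both diagonals the two interleaved strips give one point each;
    otherwise the column \<open>x = 1\<close> and \<open>side_hit\<close> do.\<close>
  have rows: "2 \<le> card (Q \<inter> piercing_points)" if y: "y = 9/10 \<or> y = 17/10" "y \<le> b" "b \<le> y + 4/5" "1 \<le> a" for y
  proof -
    consider "5 * (b - y) \<le> 8 * (a - 1)" "4 - 5 * (b - y) \<le> 8 * (a - 1)"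
      | "8 * (a - 1) \<le> 5 * (b - y) \<or> 8 * (a - 1) \<le> 4 - 5 * (b - y)" by linarith
    then show ?thesis
    proof cases
      case 1
      show ?thesis
        by (rule card_ge_two[OF zigzag_hit_integers_below[OF y(2,3) 1(1) assms(1)]
              zigzag_hit_integers_above[OF y(2,3) 1(2) assms(1)]]) (use y(1) in \<open>auto simp: piercing_points_def\<close>)
    next
      case 2
      then have a: "a \<le> 3/2" using y(2,3) by argo
      have "Q \<inter> {1} \<times> {y, y + 4/5} \<noteq> {}"
        using first_column_disc_hit[OF y(4) a y(2,3) 2] by auto
      from card_ge_two[OF this side_hit[OF a assms(2)]] show ?thesis
        using y(1) by (auto simp: piercing_points_def)
    qed
  qed
  consider "a \<le> 1" | "1 \<le> a" "a \<le> 3/2" "b \<le> 9/10" | "3/2 \<le> a" "b \<le> 9/10"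
    | "1 \<le> a" "9/10 \<le> b" "b \<le> 17/10" | "1 \<le> a" "17/10 \<le> b"
    by linarith
  then show ?thesis
  proof cases
    case 1
    then have "a \<le> 3/2" by simp
    from card_ge_two[OF first_column_hit[OF 1 assms(2)] side_hit[OF this assms(2)]] show ?thesis
      by (auto simp: piercing_points_def)
  next
    case 2
    then have "Q \<inter> {1, 2} \<times> {9/10} \<noteq> {}"
      using floor_hit[of 1 2 "9/10" "9/10" "9/10"] by (auto simp: power2_eq_square)
    from card_ge_two[OF this side_hit[OF 2(2) assms(2)]] show ?thesis
      by (auto simp: piercing_points_def)
  next
    case 3
    have "Q \<inter> {1, 2, 3} \<times> {9/10} \<noteq> {}"
      using floor_hit[of 1 2 "9/10" "9/10" "9/10"] floor_hit[of 2 3 "9/10" "9/10" "9/10"] 3 assms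
      by (cases "a \<le> 2") (auto simp: power2_eq_square)
    moreover have "Q \<inter> {3/2, 5/2} \<times> {9/10} \<noteq> {}"
      using floor_hit[of "3/2" "5/2" "9/10" "9/10" "9/10"] 3 assms by (auto simp: power2_eq_square)
    ultimately show ?thesis by (rule card_ge_two) (auto simp: piercing_points_def)
  next
    case 4
    then show ?thesis using rows[of "9/10"] by simp
  next
    case 5
    then show ?thesis using rows[of "17/10"] assms by simp
  qed
qed

end

section \<open>Reflection into the other quarters\<close>

lemma piercing_points_reflect:
  assumes "(x, y) \<in> piercing_points"
  shows "(5 - x, y) \<in> piercing_points" "(x, 5 - y) \<in> piercing_points"
  using assms unfolding piercing_points_def by auto

lemma card_reflect_fst:
  "card (tilted_square S C (5 - a) b \<inter> piercing_points) = card (tilted_square C S a b \<inter> piercing_points)"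
proof -
  let ?f = "\<lambda>(x, y). (5 - x, y) :: real \<times> real"
  have "?f z \<in> tilted_square S C (5 - a) b \<inter> piercing_points" if "z \<in> tilted_square C S a b \<inter> piercing_points" for z C S a
    using that by (cases z) (simp add: tilted_square_reflect_fst piercing_points_reflect(1))
  from this[of _ C S a] this[of _ S C "5 - a"]
  have "bij_betw ?f (tilted_square C S a b \<inter> piercing_points) (tilted_square S C (5 - a) b \<inter> piercing_points)"
    by (intro bij_betw_byWitness[where f' = ?f] ballI image_subsetI) (simp_all add: case_prod_beta)
  then show ?thesis by (simp add: bij_betw_same_card)
qed

lemma card_reflect_snd:
  "card (tilted_square S C a (5 - b) \<inter> piercing_points) = card (tilted_square C S a b \<inter> piercing_points)"
proof -
  let ?f = "\<lambda>(x, y). (x, 5 - y) :: real \<times> real"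
  have "?f z \<in> tilted_square S C a (5 - b) \<inter> piercing_points" if "z \<in> tilted_square C S a b \<inter> piercing_points" for z C S b
    using that by (cases z) (simp add: tilted_square_reflect_snd piercing_points_reflect(2))
  from this[of _ C S b] this[of _ S C "5 - b"]
  have "bij_betw ?f (tilted_square C S a b \<inter> piercing_points) (tilted_square S C a (5 - b) \<inter> piercing_points)"
    by (intro bij_betw_byWitness[where f' = ?f] ballI image_subsetI) (simp_all add: case_prod_beta)
  then show ?thesis by (simp add: bij_betw_same_card)
qed

lemma two_points:
  assumes "0 \<le> C" "0 \<le> S" "C\<^sup>2 + S\<^sup>2 = 1"
    and "(C + S) / 2 \<le> a" "a \<le> 5 - (C + S) / 2" "(C + S) / 2 \<le> b" "b \<le> 5 - (C + S) / 2"
  shows "2 \<le> card (tilted_square C S a b \<inter> piercing_points)"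
proof -
  have left: "2 \<le> card (tilted_square C S a b \<inter> piercing_points)"
    if "0 \<le> C" "0 \<le> S" "C\<^sup>2 + S\<^sup>2 = 1" "(C + S) / 2 \<le> a" "a \<le> 5/2"
      "(C + S) / 2 \<le> b" "b \<le> 5 - (C + S) / 2" for C S a b
  proof (cases "b \<le> 5/2")
    case True
    interpret square_in_quadrant C S a b using that by unfold_locales
    show ?thesis using two_points_quadrant that True by simp
  next
    case False
    interpret square_in_quadrant S C a "5 - b" using that by unfold_locales (simp_all add: field_simps)
    show ?thesis using two_points_quadrant that False by (simp add: card_reflect_snd)
  qed
  show ?thesis
  proof (cases "a \<le> 5/2")
    case True
    then show ?thesis using left assms by simp
  next
    case False
    moreover have "(S + C) / 2 \<le> 5 - a" using assms(5) by argo
    ultimately show ?thesis using left[of S C "5 - a" b] assms by (simp add: card_reflect_fst add.commute)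
  qed
qed

section \<open>From orthonormal frames to coordinates, and scaling\<close>

text \<open>Here \<epsilon> is the determinant of the pair, whose square is 1 by Lagrange's
  identity.\<close>

lemma orthonormal_pair_real:
  fixes p q p' q' :: real
  assumes "p\<^sup>2 + q\<^sup>2 = 1" "p'\<^sup>2 + q'\<^sup>2 = 1" "p * p' + q * q' = 0"
  obtains \<epsilon> where "\<epsilon> = 1 \<or> \<epsilon> = -1" "p' = - \<epsilon> * q" "q' = \<epsilon> * p"
proof
  have "(p * q' - q * p')\<^sup>2 = (p\<^sup>2 + q\<^sup>2) * (p'\<^sup>2 + q'\<^sup>2) - (p * p' + q * q')\<^sup>2" by algebra
  then show "p * q' - q * p' = 1 \<or> p * q' - q * p' = -1"
    using assms by (simp add: power2_eq_1_iff)
  show "p' = - (p * q' - q * p') * q" "q' = (p * q' - q * p') * p"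
    using assms by algebra+
qed

lemma orthonormal_expansion:
  fixes u v w :: "real^2"
  assumes "norm u = 1" "norm v = 1" "u \<bullet> v = 0"
  shows "w = (w \<bullet> u) *\<^sub>R u + (w \<bullet> v) *\<^sub>R v"
proof -
  have uv: "(u $ 1)\<^sup>2 + (u $ 2)\<^sup>2 = 1" "(v $ 1)\<^sup>2 + (v $ 2)\<^sup>2 = 1" "u $ 1 * v $ 1 + u $ 2 * v $ 2 = 0"
    using assms by (simp_all add: norm_eq_1 inner_vec_def sum_2 power2_eq_square)
  from orthonormal_pair_real[OF this] obtain \<epsilon> where
    "\<epsilon> = 1 \<or> \<epsilon> = -1" and v: "v $ 1 = - \<epsilon> * u $ 2" "v $ 2 = \<epsilon> * u $ 1" .
  then have e: "\<epsilon>\<^sup>2 = 1" by auto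
  have "w $ 1 = (w $ 1 * u $ 1 + w $ 2 * u $ 2) * u $ 1 + (w $ 1 * v $ 1 + w $ 2 * v $ 2) * v $ 1"
    "w $ 2 = (w $ 1 * u $ 1 + w $ 2 * u $ 2) * u $ 2 + (w $ 1 * v $ 1 + w $ 2 * v $ 2) * v $ 2"
    unfolding v using uv(1) e by algebra+
  then show ?thesis
    by (simp add: vec_eq_iff forall_2 inner_vec_def sum_2)
qed

text \<open>A square is invariant under quarter turns about its center, so its direction can be
  turned into the first quadrant.\<close>

lemma normalize_direction:
  fixes p q :: real
  assumes "p\<^sup>2 + q\<^sup>2 = 1"
  obtains C S where "0 \<le> C" "0 \<le> S" "C\<^sup>2 + S\<^sup>2 = 1" "C + S = \<bar>p\<bar> + \<bar>q\<bar>"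
    "\<And>X Y r. \<bar>X * C + Y * S\<bar> \<le> r \<Longrightarrow> \<bar>Y * C - X * S\<bar> \<le> r \<Longrightarrow>
       \<bar>X * p + Y * q\<bar> \<le> r \<and> \<bar>Y * p - X * q\<bar> \<le> r"
proof (cases "(0 \<le> p \<and> 0 \<le> q) \<or> (p \<le> 0 \<and> q \<le> 0)")
  case True
  then show ?thesis
    using assms by (intro that[of "\<bar>p\<bar>" "\<bar>q\<bar>"]) (auto simp: abs_le_iff)
next
  case False
  then show ?thesis
    using assms by (intro that[of "\<bar>q\<bar>" "\<bar>p\<bar>"]) (auto simp: abs_le_iff add.commute)
qed

lemma unit_square_interior:
  fixes c u v :: "real^2"
  assumes uv: "norm u = 1" "norm v = 1" "u \<bullet> v = 0"
    and x: "\<bar>(x - (c + (1/2) *\<^sub>R u + (1/2) *\<^sub>R v)) \<bullet> u\<bar> < 1/2" "\<bar>(x - (c + (1/2) *\<^sub>R u + (1/2) *\<^sub>R v)) \<bullet> v\<bar> < 1/2"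
  shows "x \<in> interior {c + a *\<^sub>R u + b *\<^sub>R v | a b. 0 \<le> a \<and> a \<le> 1 \<and> 0 \<le> b \<and> b \<le> 1}" (is "x \<in> interior ?Q")
proof (rule interiorI)
  let ?m = "c + (1/2) *\<^sub>R u + (1/2) *\<^sub>R v"
  let ?U = "{x. \<bar>(x - ?m) \<bullet> u\<bar> < 1/2} \<inter> {x. \<bar>(x - ?m) \<bullet> v\<bar> < 1/2}"
  show "open ?U" by (intro open_Int open_Collect_less continuous_intros)
  show "x \<in> ?U" using x by simp
  show "?U \<subseteq> ?Q"
  proof
    fix y assume y: "y \<in> ?U"
    have "y - c = ((y - c) \<bullet> u) *\<^sub>R u + ((y - c) \<bullet> v) *\<^sub>R v"
      by (rule orthonormal_expansion[OF uv])
    then have "y = c + ((y - c) \<bullet> u) *\<^sub>R u + ((y - c) \<bullet> v) *\<^sub>R v" by (simp add: algebra_simps)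
    moreover have "(y - ?m) \<bullet> u = (y - c) \<bullet> u - 1/2" "(y - ?m) \<bullet> v = (y - c) \<bullet> v - 1/2"
      using uv by (simp_all add: inner_simps norm_eq_1 inner_commute)
    then have "0 \<le> (y - c) \<bullet> u \<and> (y - c) \<bullet> u \<le> 1 \<and> 0 \<le> (y - c) \<bullet> v \<and> (y - c) \<bullet> v \<le> 1"
      using y unfolding Int_iff mem_Collect_eq abs_less_iff by linarith
    ultimately show "y \<in> ?Q" by blast
  qed
qed

lemma two_points_interior:
  fixes c u v :: "real^2"
  assumes uv: "norm u = 1" "norm v = 1" "u \<bullet> v = 0" and s: "0 < s" "s < 5"
    and Q: "is_square 1 Q" "Q \<subseteq> {c + a *\<^sub>R u + b *\<^sub>R v | a b. 0 \<le> a \<and> a \<le> s \<and> 0 \<le> b \<and> b \<le> s}"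
  shows "2 \<le> card {(x, y) \<in> piercing_points. c + (s/5 * x) *\<^sub>R u + (s/5 * y) *\<^sub>R v \<in> interior Q}"
proof -
  obtain c' u' v' where uv': "norm u' = 1" "norm v' = 1" "u' \<bullet> v' = 0"
    and Q_eq: "Q = {c' + a *\<^sub>R u' + b *\<^sub>R v' | a b. 0 \<le> a \<and> a \<le> 1 \<and> 0 \<le> b \<and> b \<le> 1}"
    using Q(1) unfolding is_square_def by blast
  define p q p' q' where "p = u' \<bullet> u" "q = u' \<bullet> v" "p' = v' \<bullet> u" "q' = v' \<bullet> v"
  note pq_defs = this
  have u': "u' = p *\<^sub>R u + q *\<^sub>R v" and v': "v' = p' *\<^sub>R u + q' *\<^sub>R v"
    unfolding pq_defs by (rule orthonormal_expansion[OF uv])+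
  have inner_uv: "u \<bullet> u = 1" "v \<bullet> v = 1" "u \<bullet> v = 0" "v \<bullet> u = 0"
    using uv by (simp_all add: norm_eq_1 inner_commute)
  have inner_comb: "(k *\<^sub>R u + l *\<^sub>R v) \<bullet> (k' *\<^sub>R u + l' *\<^sub>R v) = k * k' + l * l'" for k l k' l'
    by (simp add: inner_add_left inner_add_right inner_uv)
  have pq: "p\<^sup>2 + q\<^sup>2 = 1" "p'\<^sup>2 + q'\<^sup>2 = 1" "p * p' + q * q' = 0"
    using uv' by (simp_all add: norm_eq_1 u' v' inner_comb power2_eq_square)
  obtain \<epsilon> where \<epsilon>: "\<epsilon> = 1 \<or> \<epsilon> = -1" and pq': "p' = - \<epsilon> * q" "q' = \<epsilon> * p"
    using orthonormal_pair_real[OF pq] .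
  obtain C S where CS: "0 \<le> C" "0 \<le> S" "C\<^sup>2 + S\<^sup>2 = 1" "C + S = \<bar>p\<bar> + \<bar>q\<bar>"
    and CS_pq: "\<And>X Y r. \<bar>X * C + Y * S\<bar> \<le> r \<Longrightarrow> \<bar>Y * C - X * S\<bar> \<le> r \<Longrightarrow>
       \<bar>X * p + Y * q\<bar> \<le> r \<and> \<bar>Y * p - X * q\<bar> \<le> r"
    using normalize_direction[OF pq(1)] by blast
  define x0 y0 where "x0 = (c' - c) \<bullet> u" "y0 = (c' - c) \<bullet> v"
  have c': "c' - c = x0 *\<^sub>R u + y0 *\<^sub>R v"
    unfolding x0_y0_def by (rule orthonormal_expansion[OF uv])
  have corner: "0 \<le> x0 + a * p + b * p' \<and> x0 + a * p + b * p' \<le> s \<and> 0 \<le> y0 + a * q + b * q' \<and> y0 + a * q + b * q' \<le> s"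
    if "0 \<le> a" "a \<le> 1" "0 \<le> b" "b \<le> 1" for a b
  proof -
    have "c' + a *\<^sub>R u' + b *\<^sub>R v' \<in> Q" using that unfolding Q_eq by blast
    then obtain k l where kl: "0 \<le> k" "k \<le> s" "0 \<le> l" "l \<le> s"
      and eq: "c' + a *\<^sub>R u' + b *\<^sub>R v' = c + k *\<^sub>R u + l *\<^sub>R v" using Q(2) by blast
    have "(x0 + a * p + b * p') *\<^sub>R u + (y0 + a * q + b * q') *\<^sub>R v = (c' - c) + a *\<^sub>R u' + b *\<^sub>R v'"
      unfolding c' u' v' by (simp add: algebra_simps)
    also have "\<dots> = k *\<^sub>R u + l *\<^sub>R v" using eq by (simp add: algebra_simps)
    finally have *: "(x0 + a * p + b * p') *\<^sub>R u + (y0 + a * q + b * q') *\<^sub>R v = k *\<^sub>R u + l *\<^sub>R v" .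
    have "x0 + a * p + b * p' = k" "y0 + a * q + b * q' = l"
      using arg_cong[OF *, of "\<lambda>w. w \<bullet> u"] arg_cong[OF *, of "\<lambda>w. w \<bullet> v"]
      by (simp_all add: inner_add_left inner_uv)
    then show ?thesis using kl by simp
  qed
  define m1 m2 where "m1 = x0 + (p + p') / 2" "m2 = y0 + (q + q') / 2"
  note m_defs = this
  let ?h = "(C + S) / 2"
  have m: "?h \<le> m1" "m1 \<le> s - ?h" "?h \<le> m2" "m2 \<le> s - ?h"
  proof -
    \<comment> \<open>In each coordinate, the corners of the small square are \<open>t\<close>,
      \<open>t + k\<close>, \<open>t + l\<close>, \<open>t + k + l\<close>; their midpoint is the
      center and half their range is \<open>(\<bar>k\<bar> + \<bar>l\<bar>) / 2\<close>.\<close>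
    have box: "(\<bar>k\<bar> + \<bar>l\<bar>) / 2 \<le> t + (k + l) / 2 \<and> t + (k + l) / 2 \<le> s - (\<bar>k\<bar> + \<bar>l\<bar>) / 2"
      if "0 \<le> t" "t \<le> s" "0 \<le> t + k" "t + k \<le> s" "0 \<le> t + l" "t + l \<le> s" "0 \<le> t + k + l" "t + k + l \<le> s"
      for t k l
      using that by (cases "0 \<le> k"; cases "0 \<le> l"; simp add: field_simps)
    have "\<bar>p'\<bar> = \<bar>q\<bar>" "\<bar>q'\<bar> = \<bar>p\<bar>" using \<epsilon> unfolding pq' by (auto simp: abs_mult)
    then show "?h \<le> m1" "m1 \<le> s - ?h" "?h \<le> m2" "m2 \<le> s - ?h"
      using box[of x0 p p'] box[of y0 q q'] corner[of 0 0] corner[of 0 1] corner[of 1 0] corner[of 1 1]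
      unfolding CS(4) m_defs by (simp_all add: add.commute)
  qed
  have h_nonneg: "0 \<le> ?h" using CS by simp
  \<comment> \<open>Scaling only the center by \<open>5 / s > 1\<close> keeps a unit square inside
    the square of side 5. Scaling everything back shrinks it to side \<open>s / 5\<close> about the
    original center.\<close>
  have scale: "?h \<le> 5 / s * t" "5 / s * t \<le> 5 - ?h" if "?h \<le> t" "t \<le> s - ?h" for t
  proof -
    have "?h * s \<le> t * 5" "?h * s \<le> ?h * 5"
      using that h_nonneg s by (intro mult_mono mult_left_mono; simp)+
    then show "?h \<le> 5 / s * t" "5 / s * t \<le> 5 - ?h"
      using that s by (simp_all add: field_simps)
  qed
  let ?T = "tilted_square C S (5 / s * m1) (5 / s * m2)"
  have "2 \<le> card (?T \<inter> piercing_points)"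
    using two_points[OF CS(1-3)] scale m by blast
  also have "\<dots> \<le> card {(x, y) \<in> piercing_points. c + (s/5 * x) *\<^sub>R u + (s/5 * y) *\<^sub>R v \<in> interior Q}"
  proof (rule card_mono)
    show "finite {(x, y) \<in> piercing_points. c + (s/5 * x) *\<^sub>R u + (s/5 * y) *\<^sub>R v \<in> interior Q}"
      by (rule finite_subset[OF _ finite_piercing_points]) auto
    have "c + (s/5 * x) *\<^sub>R u + (s/5 * y) *\<^sub>R v \<in> interior Q" if "(x, y) \<in> ?T" for x y
    proof -
      define X Y where "X = s/5 * x - m1" "Y = s/5 * y - m2"
      have XY: "X = s/5 * (x - 5 / s * m1)" "Y = s/5 * (y - 5 / s * m2)"
        using s by (simp_all add: X_Y_def field_simps)
      have eq: "X * C + Y * S = s/5 * ((x - 5 / s * m1) * C + (y - 5 / s * m2) * S)"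
        "Y * C - X * S = s/5 * ((y - 5 / s * m2) * C - (x - 5 / s * m1) * S)"
        unfolding XY by (simp_all add: algebra_simps)
      have "\<bar>s/5\<bar> * \<bar>(x - 5 / s * m1) * C + (y - 5 / s * m2) * S\<bar> \<le> \<bar>s/5\<bar> * (1/2)"
        "\<bar>s/5\<bar> * \<bar>(y - 5 / s * m2) * C - (x - 5 / s * m1) * S\<bar> \<le> \<bar>s/5\<bar> * (1/2)"
        using that unfolding tilted_square_def by (intro mult_left_mono; simp)+
      then have "\<bar>X * C + Y * S\<bar> \<le> s / 10" "\<bar>Y * C - X * S\<bar> \<le> s / 10"
        using s unfolding eq abs_mult by simp_all
      \<comment> \<open>Here \<open>s < 5\<close> turns the closed bounds into strict ones, as
        needed for the interior.\<close>
      then have XYpq: "\<bar>X * p + Y * q\<bar> < 1/2" "\<bar>Y * p - X * q\<bar> < 1/2"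
        using CS_pq[of X Y "s / 10"] s by auto
      have "c + (s/5 * x) *\<^sub>R u + (s/5 * y) *\<^sub>R v - (c' + (1/2) *\<^sub>R u' + (1/2) *\<^sub>R v')
          = (s/5 * x) *\<^sub>R u + (s/5 * y) *\<^sub>R v - (c' - c) - (1/2) *\<^sub>R u' - (1/2) *\<^sub>R v'"
        by simp
      also have "\<dots> = X *\<^sub>R u + Y *\<^sub>R v"
        unfolding c' u' v' X_Y_def m_defs by (simp add: algebra_simps add_divide_distrib)
      finally have diff: "c + (s/5 * x) *\<^sub>R u + (s/5 * y) *\<^sub>R v - (c' + (1/2) *\<^sub>R u' + (1/2) *\<^sub>R v')
          = X *\<^sub>R u + Y *\<^sub>R v" .
      have "X * p' + Y * q' = \<epsilon> * (Y * p - X * q)"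
        by (simp add: pq' algebra_simps)
      then have "\<bar>X * p' + Y * q'\<bar> = \<bar>Y * p - X * q\<bar>"
        using \<epsilon> by (auto simp: abs_mult)
      moreover have "(X *\<^sub>R u + Y *\<^sub>R v) \<bullet> u' = X * p + Y * q" "(X *\<^sub>R u + Y *\<^sub>R v) \<bullet> v' = X * p' + Y * q'"
        unfolding u' v' by (rule inner_comb)+
      ultimately show ?thesis
        unfolding Q_eq using XYpq by (intro unit_square_interior[OF uv']) (simp_all only: diff)
    qed
    then show "?T \<inter> piercing_points \<subseteq> {(x, y) \<in> piercing_points. c + (s/5 * x) *\<^sub>R u + (s/5 * y) *\<^sub>R v \<in> interior Q}"
      by auto
  qed
  finally show ?thesis .
qed

section \<open>Counting points in disjoint interiors\<close>

theorem theorem11: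
  fixes s :: real and S :: "(real^2) set"
  assumes "is_square s S" and "s < 5"
  shows "\<not> (\<exists>F. card F = 22 \<and> (\<forall>Q\<in>F. is_square 1 Q) \<and> non_overlapping F \<and> packed_in F S)"
proof
  assume "\<exists>F. card F = 22 \<and> (\<forall>Q\<in>F. is_square 1 Q) \<and> non_overlapping F \<and> packed_in F S"
  then obtain F where F: "card F = 22" "\<And>Q. Q \<in> F \<Longrightarrow> is_square 1 Q"
    "non_overlapping F" "packed_in F S" by blast
  obtain c u v where uv: "norm u = 1" "norm v = 1" "u \<bullet> v = 0" and s: "0 < s"
    and S: "S = {c + a *\<^sub>R u + b *\<^sub>R v | a b. 0 \<le> a \<and> a \<le> s \<and> 0 \<le> b \<and> b \<le> s}"
    using assms(1) unfolding is_square_def by blast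
  define P where "P Q = {(x, y) \<in> piercing_points. c + (s/5 * x) *\<^sub>R u + (s/5 * y) *\<^sub>R v \<in> interior Q}" for Q
  have P_subset: "P Q \<subseteq> piercing_points" for Q by (auto simp: P_def)
  then have "finite (P Q)" for Q using finite_subset finite_piercing_points by blast
  \<comment> \<open>Infinite sets have \<open>card\<close> 0, so cardinality 22 implies
    finiteness.\<close>
  have "finite F" using F(1) card_ge_0_finite by force
  have disj: "P Q \<inter> P Q' = {}" if "Q \<in> F" "Q' \<in> F" "Q \<noteq> Q'" for Q Q'
    using F(3) that unfolding non_overlapping_def pairwise_def disjnt_def P_def by blast
  have "2 \<le> card (P Q)" if "Q \<in> F" for Q
    unfolding P_def using F(2,4) that unfolding packed_in_def S
    by (intro two_points_interior[OF uv s assms(2)]) auto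
  then have "(\<Sum>Q\<in>F. 2) \<le> (\<Sum>Q\<in>F. card (P Q))" by (rule sum_mono)
  also have "\<dots> = card (\<Union>Q\<in>F. P Q)"
    using \<open>finite F\<close> \<open>\<And>Q. finite (P Q)\<close> disj by (simp add: card_UN_disjoint)
  also have "\<dots> \<le> card piercing_points" using P_subset finite_piercing_points by (intro card_mono) auto
  also have "\<dots> \<le> 43" by (rule card_piercing_points)
  finally show False using F(1) by simp
qed

end
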